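(* Let $F=\frac1n\sum_{i=1}^nF_i$ with $F_i:\mathbb{R}^d\to\mathbb{R}^d$, let $b\in\{1,\dots,n\}$, and for $S\subseteq\{1,\dots,n\}$ with $|S|=b$ let $F_S=\frac1b\sum_{i\in S}F_i$. Assume each $F_i$ is $L_i$-Lipschitz and satisfies $\langle F_i(x)-F_i(x^* ),x-x^*\rangle\ge\mu_i\|x-x^*\|^2$ for all $x$ (with possibly negative $\mu_i$). Let $L_S>0$ be the Lipschitz constant of $F_S$ and let $\mu_S\ge\frac1b\sum_{i\in S}\mu_i$, $|\mu_S|\le L_S$, be such that $\langle F_S(x)-F_S(x^* ),x-x^*\rangle\ge\mu_S\|x-x^*\|^2$ for all $x$. Assume $$\overline\mu_{b\text{-}NICE}=\frac{1}{\binom nb}\left(\sum_{|S|=b,\ \mu_S\ge0}\mu_S+4\sum_{|S|=b,\ \mu_S<0}\mu_S\right)\ge0.$$ Let $\xi^k$ be a uniformly random $b$-element subset of $\{1,\dots,n\}$, let $\gamma_{2,\xi^k}=\alpha\gamma_{1,\xi^k}$ with $0<\alpha<1$, and $\gamma_{1,\xi^k}=\gamma$, $0<\gamma\le\frac{1}{6L_{b\text{-}NICE}}$, $L_{b\text{-}NICE}=\max_{|S|=b}L_S$. Let $\sigma_{b\text{-}NICE*}^2=\frac{1}{\binom nb}\sum_{|S|=b}\|F_S(x^* )\|^2$. Then $g^k=F_{\xi^k}(x^k-\gamma_{1,\xi^k}F_{\xi^k}(x^k))$, with stepsize $\gamma_{2,\xi^k}$, satisfies the unified assumption (see context) with $$A=2\alpha,\quad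 C=0,\quad D_1=6\alpha^2\gamma^2\sigma_{b\text{-}NICE*}^2,\quad\rho=\frac{\alpha\gamma\overline\mu_{b\text{-}NICE}}{2},$$ $$G_k=\frac{\alpha\gamma^2}{\binom nb}\sum_{|S|=b}\left(1-4|\mu_S|\gamma-2L_S^2\gamma^2\right)\|F_S(x^k)\|^2,\quad B=\frac12,\quad D_2=\frac{3\alpha\gamma^2}{2}\sigma_{b\text{-}NICE*}^2.$$ If additionally $\alpha\le\frac14$, then for all $K\ge0$: in the case $\overline\mu_{b\text{-}NICE}>0$, $$\mathbb{E}\left[\|x^{K+1}-x^*\|^2\right]\le\left(1-\frac{\alpha\gamma\overline\mu_{b\text{-}NICE}}{2}\right)\mathbb{E}\left[\|x^K-x^*\|^2\right]+\frac{3\alpha}{2}(4\alpha+1)\gamma^2\sigma_{b\text{-}NICE*}^2,$$ $$\mathbb{E}\left[\|x^K-x^*\|^2\right]\le\left(1-\frac{\alpha\gamma\overline\mu_{b\text{-}NICE}}{2}\right)^K\|x^0-x^*\|^2+\frac{3(4\alpha+1)\gamma\sigma_{b\text{-}NICE*}^2}{\overline\mu_{b\text{-}NICE}};$$ and in the case $\overline\mu_{b\text{-}NICE}=0$, $$\frac{1}{K+1}\sum_{k=0}^K\mathbb{E}\left[\frac{1}{\binom nb}\sum_{|S|=b}\left(1-4|\mu_S|\gamma-2L_S^2\gamma^2\right)\|F_S(x^k)\|^2\right]\le\frac{2\|x^0-x^*\|^2}{\alpha\gamma^2(K+1)}+3(4\alpha+1)\sigma_{b\text{-}NICE*}^2.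$$
   Context: $x^*\in\mathbb{R}^d$ satisfies $F(x^* )=0$, $\|\cdot\|$ is the Euclidean norm. All sums and maxima over $|S|=b$ range over subsets $S\subseteq\{1,\dots,n\}$ of size $b$. The samples $\xi^0,\xi^1,\dots$ are independent; $\mathbb{E}_{\xi^k}$ is the expectation over $\xi^k$ only (conditional on $x^k$). Same-sample stochastic extragradient (S-SEG), started at a deterministic $x^0$, is $x^{k+1}=x^k-\gamma_{2,\xi^k}F_{\xi^k}(x^k-\gamma_{1,\xi^k}F_{\xi^k}(x^k))$, $k\ge0$. Unified assumption for a method $x^{k+1}=x^k-\gamma_{\xi^k}g^k$ with parameters $A,B,C,D_1,D_2\ge0$, $\rho\in[0,1]$ and non-negative $G_k$: with $P_k=\mathbb{E}_{\xi^k}[\gamma_{\xi^k}\langle g^k,x^k-x^*\rangle]$, for all $k\ge 0$, $$\mathbb{E}_{\xi^k}[\gamma_{\xi^k}^2\|g^k\|^2]\le2AP_k+C\|x^k-x^*\|^2+D_1,\qquad P_k\ge\rho\|x^k-x^*\|^2+BG_k-D_2.$$ Here $\gamma_{\xi^k}=\gamma_{2,\xi^k}$. *)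

theory Defs
  imports "HOL-Probability.Probability"
begin

definition batches :: "nat \<Rightarrow> nat \<Rightarrow> nat set set" where
  "batches n b = {S. S \<subseteq> {1..n} \<and> card S = b}"

definition batch_mean :: "nat \<Rightarrow> nat \<Rightarrow> (nat set \<Rightarrow> real) \<Rightarrow> real" where
  "batch_mean n b h = 1 / real (n choose b) * (\<Sum>S\<in>batches n b. h S)"

text \<open>The full operator is the case \<open>S = {1..n}\<close>.\<close>

definition avg_op :: "(nat \<Rightarrow> 'a \<Rightarrow> 'a) \<Rightarrow> nat set \<Rightarrow> 'a \<Rightarrow> 'a::real_vector" where
  "avg_op F S x = (1 / real (card S)) *\<^sub>R (\<Sum>i\<in>S. F i x)"

definition mu_nice :: "nat \<Rightarrow> nat \<Rightarrow> (nat set \<Rightarrow> real) \<Rightarrow> real" where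
  "mu_nice n b \<mu> = 1 / real (n choose b) *
     ((\<Sum>S\<in>{S \<in> batches n b. \<mu> S \<ge> 0}. \<mu> S) + 4 * (\<Sum>S\<in>{S \<in> batches n b. \<mu> S < 0}. \<mu> S))"

definition L_nice :: "nat \<Rightarrow> nat \<Rightarrow> (nat set \<Rightarrow> real) \<Rightarrow> real" where
  "L_nice n b L = Max (L ` batches n b)"

definition sigma2_nice ::
  "nat \<Rightarrow> nat \<Rightarrow> (nat \<Rightarrow> 'a \<Rightarrow> 'a::real_normed_vector) \<Rightarrow> 'a \<Rightarrow> real" where
  "sigma2_nice n b F xs = batch_mean n b (\<lambda>S. (norm (avg_op F S xs))\<^sup>2)"

definition nice_sampling ::
  "'w measure \<Rightarrow> nat \<Rightarrow> nat \<Rightarrow> (nat \<Rightarrow> 'w \<Rightarrow> nat set) \<Rightarrow> bool" where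
  "nice_sampling M n b \<xi> \<longleftrightarrow>
     prob_space M \<and>
     prob_space.indep_vars M (\<lambda>_. count_space (batches n b)) \<xi> UNIV \<and>
     (\<forall>k. distr M (count_space (batches n b)) (\<xi> k) = uniform_count_measure (batches n b))"

text \<open>Same-sample stochastic extragradient. \<open>Fs s\<close> is the operator and \<open>\<gamma>1 s\<close>, \<open>\<gamma>2 s\<close> are the
  stepsizes associated with a sample value \<open>s\<close>.\<close>

definition sseg_dir :: "('s \<Rightarrow> 'a \<Rightarrow> 'a) \<Rightarrow> ('s \<Rightarrow> real) \<Rightarrow> 's \<Rightarrow> 'a \<Rightarrow> 'a::real_vector" where
  "sseg_dir Fs \<gamma>1 s x = Fs s (x - \<gamma>1 s *\<^sub>R Fs s x)"

primrec sseg ::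
  "('s \<Rightarrow> 'a \<Rightarrow> 'a) \<Rightarrow> ('s \<Rightarrow> real) \<Rightarrow> ('s \<Rightarrow> real) \<Rightarrow> (nat \<Rightarrow> 'w \<Rightarrow> 's) \<Rightarrow> 'a
     \<Rightarrow> nat \<Rightarrow> 'w \<Rightarrow> 'a::real_vector" where
  "sseg Fs \<gamma>1 \<gamma>2 \<xi> x0 0 \<omega> = x0"
| "sseg Fs \<gamma>1 \<gamma>2 \<xi> x0 (Suc k) \<omega> =
     sseg Fs \<gamma>1 \<gamma>2 \<xi> x0 k \<omega>
       - \<gamma>2 (\<xi> k \<omega>) *\<^sub>R sseg_dir Fs \<gamma>1 (\<xi> k \<omega>) (sseg Fs \<gamma>1 \<gamma>2 \<xi> x0 k \<omega>)"

definition cond_exp_given ::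
  "'w measure \<Rightarrow> ('w \<Rightarrow> 'a::topological_space) \<Rightarrow> ('w \<Rightarrow> real) \<Rightarrow> 'w \<Rightarrow> real" where
  "cond_exp_given M X f = real_cond_exp M (vimage_algebra (space M) X borel) f"

text \<open>The unified assumption for \<open>x\<^sup>k\<^sup>+\<^sup>1 = x\<^sup>k - \<gamma>\<^sub>k g\<^sup>k\<close>, with \<open>\<gamma> k\<close>, \<open>g k\<close>, \<open>G k\<close> random. Conditional
  expectations are determined only almost everywhere; the measurability and integrability
  clauses ensure that the library's total function \<open>real_cond_exp\<close> is used where it is
  meaningful.\<close>

definition unified_assumption ::
  "'w measure \<Rightarrow> (nat \<Rightarrow> 'w \<Rightarrow> 'a::euclidean_space) \<Rightarrow> (nat \<Rightarrow> 'w \<Rightarrow> real) \<Rightarrow> (nat \<Rightarrow> 'w \<Rightarrow> 'a) \<Rightarrow> 'a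
     \<Rightarrow> real \<Rightarrow> real \<Rightarrow> real \<Rightarrow> real \<Rightarrow> real \<Rightarrow> real \<Rightarrow> (nat \<Rightarrow> 'w \<Rightarrow> real) \<Rightarrow> bool" where
  "unified_assumption M x \<gamma> g xs A B C D1 D2 \<rho> G \<longleftrightarrow>
     0 \<le> A \<and> 0 \<le> B \<and> 0 \<le> C \<and> 0 \<le> D1 \<and> 0 \<le> D2 \<and> 0 \<le> \<rho> \<and> \<rho> \<le> 1 \<and>
     (\<forall>k. \<forall>\<omega>\<in>space M. 0 \<le> G k \<omega>) \<and>
     (\<forall>k. \<forall>\<omega>\<in>space M. x (Suc k) \<omega> = x k \<omega> - \<gamma> k \<omega> *\<^sub>R g k \<omega>) \<and>
     (\<forall>k. x k \<in> borel_measurable M \<and>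
          integrable M (\<lambda>\<omega>. \<gamma> k \<omega> * (g k \<omega> \<bullet> (x k \<omega> - xs))) \<and>
          integrable M (\<lambda>\<omega>. (\<gamma> k \<omega>)\<^sup>2 * (norm (g k \<omega>))\<^sup>2)) \<and>
     (\<forall>k. let P = cond_exp_given M (x k) (\<lambda>\<omega>. \<gamma> k \<omega> * (g k \<omega> \<bullet> (x k \<omega> - xs)))
          in AE \<omega> in M.
               cond_exp_given M (x k) (\<lambda>\<omega>. (\<gamma> k \<omega>)\<^sup>2 * (norm (g k \<omega>))\<^sup>2) \<omega>
                 \<le> 2 * A * P \<omega> + C * (norm (x k \<omega> - xs))\<^sup>2 + D1 \<and>
               P \<omega> \<ge> \<rho> * (norm (x k \<omega> - xs))\<^sup>2 + B * G k \<omega> - D2)"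

end

theory Submission
  imports Defs
begin

text \<open>
  Fix a point \<open>y\<close> and a batch \<open>S\<close>, and write \<open>a = F\<^sub>S(y)\<close>, \<open>z = y - \<gamma> a\<close>, \<open>g = F\<^sub>S(z)\<close>, \<open>f = F\<^sub>S(x\<^sup>*)\<close>.
  Everything rests on splitting
  \<open>\<gamma> \<langle>g - f, y - x\<^sup>*\<rangle> = \<gamma> \<langle>g - f, z - x\<^sup>*\<rangle> + \<gamma>\<^sup>2 \<langle>g, a\<rangle> - \<gamma>\<^sup>2 \<langle>f, a\<rangle>\<close>.
  The first term is controlled by quasi-strong monotonicity at the extrapolated point \<open>z\<close>; moving from
  \<open>z\<close> back to \<open>y\<close> halves \<open>\<mu>\<^sub>S\<close> when it is non-negative and doubles it when it is negative, which is
  where the factor 4 in the averaged \<open>\<mu>\<close> comes from. The second term equals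
  \<open>\<gamma>\<^sup>2/2 (\<parallel>g\<parallel>\<^sup>2 + \<parallel>a\<parallel>\<^sup>2 - \<parallel>g - a\<parallel>\<^sup>2)\<close> with \<open>\<parallel>g - a\<parallel> \<le> \<gamma> L\<^sub>S \<parallel>a\<parallel>\<close>, and Young's inequality absorbs the
  third one into it at the price of a multiple of \<open>\<parallel>f\<parallel>\<^sup>2\<close>. Sharing out these terms in three ways
  gives the three bounds of \<open>sample_bounds\<close>. Averaging over \<open>S\<close> removes \<open>f\<close> from the inner product,
  because the mean of the \<open>F\<^sub>S(x\<^sup>*)\<close> is \<open>F(x\<^sup>*) = 0\<close>; this gives \<open>progress_lower\<close> and
  \<open>energy_le_progress\<close>, the two inequalities of the unified assumption divided by the proper power
  of \<open>\<alpha>\<close>.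

  The rates need one more inequality. With \<open>P\<close> the conditional mean of the inner product and \<open>Q\<close> the
  conditional second moment, one step changes the squared distance by \<open>-2P + Q\<close> on average. If
  \<open>P \<ge> 0\<close>, the unified assumption and \<open>\<alpha> \<le> 1/4\<close> bound this by \<open>-P + D\<^sub>1\<close>, hence by the claimed quantity; but
  \<open>P\<close> may be negative, and for \<open>P = -D\<^sub>2\<close>, \<open>Q = 0\<close> the unified assumption only yields \<open>2 D\<^sub>2\<close>, which
  exceeds \<open>D\<^sub>1 + D\<^sub>2\<close> as soon as \<open>\<alpha> < 1/4\<close>. The remedy is \<open>double_progress_lower\<close>, a lower bound for
  \<open>2P\<close> with the same noise term as the one for \<open>P\<close>. After division by \<open>\<alpha>\<close> the claimed one-step
  inequality is affine in \<open>\<alpha>\<close>; at \<open>\<alpha> = 0\<close> it is \<open>double_progress_lower\<close> and at \<open>\<alpha> = 1/4\<close> it follows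
  from the unified assumption, so it holds in between (\<open>mean_step_le\<close>).

  On the probabilistic side every iterate takes finitely many values and is a function of the earlier
  samples only, so it is independent of the current one. Hence conditioning on \<open>x\<^sup>k\<close> amounts to
  averaging over the batches with \<open>x\<^sup>k\<close> held fixed (\<open>cond_exp_given_fresh_sample\<close>).
\<close>

section \<open>The extragradient step for a single batch\<close>

text \<open>The point \<open>z\<close> at which the operator is evaluated differs from the current point \<open>y\<close>. Both cases
  use \<open>\<parallel>u + v\<parallel>\<^sup>2 \<le> 2\<parallel>u\<parallel>\<^sup>2 + 2\<parallel>v\<parallel>\<^sup>2\<close>, in opposite directions: for \<open>\<mu> \<ge> 0\<close> the distance of \<open>z\<close> has to be
  bounded below, for \<open>\<mu> < 0\<close> above.\<close>

lemma quasi_monotone_shift: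
  fixes H :: "'a::real_inner \<Rightarrow> 'a"
  assumes quasi: "(H z - H xs) \<bullet> (z - xs) \<ge> \<mu> * (norm (z - xs))\<^sup>2"
    and z: "z = y - \<gamma> *\<^sub>R a"
  shows "(H z - H xs) \<bullet> (z - xs)
           \<ge> (if \<mu> \<ge> 0 then \<mu> else 4 * \<mu>) / 2 * (norm (y - xs))\<^sup>2 - 2 * \<bar>\<mu>\<bar> * (\<gamma>\<^sup>2 * (norm a)\<^sup>2)"
proof -
  have par: "(norm (u + v))\<^sup>2 \<le> 2 * (norm u)\<^sup>2 + 2 * (norm v)\<^sup>2" for u v :: 'a
    using zero_le_power2[of "norm (u - v)"]
    by (simp add: power2_norm_eq_inner inner_diff_left inner_diff_right inner_add_left
        inner_add_right inner_commute)
  have sc: "(norm (\<gamma> *\<^sub>R a))\<^sup>2 = \<gamma>\<^sup>2 * (norm a)\<^sup>2"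
    by (simp add: power_mult_distrib)
  define q where "q = (H z - H xs) \<bullet> (z - xs)"
  have quasi: "\<mu> * (norm (z - xs))\<^sup>2 \<le> q" using quasi by (simp add: q_def)
  show ?thesis
  proof (cases "\<mu> \<ge> 0")
    case True
    have "(norm (y - xs))\<^sup>2 \<le> 2 * (norm (z - xs))\<^sup>2 + 2 * (\<gamma>\<^sup>2 * (norm a)\<^sup>2)"
      using par[of "z - xs" "\<gamma> *\<^sub>R a"] by (simp add: sc z del: norm_scaleR)
    hence "\<mu> * (norm (y - xs))\<^sup>2 \<le> \<mu> * (2 * (norm (z - xs))\<^sup>2 + 2 * (\<gamma>\<^sup>2 * (norm a)\<^sup>2))"
      using True by (rule mult_left_mono)
    also have "\<dots> = 2 * (\<mu> * (norm (z - xs))\<^sup>2) + 2 * (\<mu> * (\<gamma>\<^sup>2 * (norm a)\<^sup>2))"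
      by (simp add: distrib_left)
    finally have "\<mu> * (norm (y - xs))\<^sup>2
      \<le> 2 * (\<mu> * (norm (z - xs))\<^sup>2) + 2 * (\<mu> * (\<gamma>\<^sup>2 * (norm a)\<^sup>2))" .
    moreover have "0 \<le> \<mu> * (\<gamma>\<^sup>2 * (norm a)\<^sup>2)" using True by simp
    ultimately have "\<mu> / 2 * (norm (y - xs))\<^sup>2 - 2 * \<mu> * (\<gamma>\<^sup>2 * (norm a)\<^sup>2) \<le> q"
      using quasi by linarith
    thus ?thesis using True by (simp add: q_def)
  next
    case False
    have "(norm (z - xs))\<^sup>2 \<le> 2 * (norm (y - xs))\<^sup>2 + 2 * (\<gamma>\<^sup>2 * (norm a)\<^sup>2)"
      using par[of "y - xs" "- (\<gamma> *\<^sub>R a)"]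
      by (simp only: norm_minus_cancel sc) (simp add: z diff_diff_eq add.commute)
    hence "(-\<mu>) * (norm (z - xs))\<^sup>2 \<le> (-\<mu>) * (2 * (norm (y - xs))\<^sup>2 + 2 * (\<gamma>\<^sup>2 * (norm a)\<^sup>2))"
      using False by (intro mult_left_mono) auto
    also have "\<dots> = - 2 * (\<mu> * (norm (y - xs))\<^sup>2) - 2 * (\<mu> * (\<gamma>\<^sup>2 * (norm a)\<^sup>2))"
      by (simp add: distrib_left)
    finally have "2 * \<mu> * (norm (y - xs))\<^sup>2 + 2 * \<mu> * (\<gamma>\<^sup>2 * (norm a)\<^sup>2) \<le> q"
      using quasi by simp
    thus ?thesis using False by (simp add: q_def)
  qed
qed

text \<open>All three bounds come from the inequality \<open>p\<close> in the proof, and differ in what pays for the cross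
  term \<open>f \<bullet> a\<close>. In the first it is \<open>\<parallel>g\<parallel>\<^sup>2\<close>, because \<open>\<parallel>a\<parallel>\<^sup>2\<close> has to survive with coefficient \<open>c\<close>; in the
  second it is \<open>\<parallel>a\<parallel>\<^sup>2\<close> and half of \<open>\<parallel>g\<parallel>\<^sup>2\<close>, because the other half of \<open>\<parallel>g\<parallel>\<^sup>2\<close> has to survive. In the
  third, all of \<open>\<parallel>g\<parallel>\<^sup>2\<close> and half of \<open>\<parallel>a\<parallel>\<^sup>2\<close> are available, so that the left-hand side is doubled while
  the noise term stays the same.\<close>

lemma sample_bounds:
  fixes H :: "'a::real_inner \<Rightarrow> 'a" and y xs :: 'a and L \<mu> \<gamma> :: real
  defines "a \<equiv> H y" and "g \<equiv> H (y - \<gamma> *\<^sub>R H y)" and "f \<equiv> H xs"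
  defines "r \<equiv> (if \<mu> \<ge> 0 then \<mu> else 4 * \<mu>) * (norm (y - xs))\<^sup>2"
    and "p \<equiv> (g - f) \<bullet> (y - xs)"
    and "c \<equiv> 1 - 4 * \<bar>\<mu>\<bar> * \<gamma> - 2 * L\<^sup>2 * \<gamma>\<^sup>2"
  assumes lip: "L-lipschitz_on UNIV H"
    and quasi: "\<And>z. (H z - H xs) \<bullet> (z - xs) \<ge> \<mu> * (norm (z - xs))\<^sup>2"
    and mu: "\<bar>\<mu>\<bar> \<le> L" and \<gamma>: "0 < \<gamma>" "\<gamma> * L \<le> 1 / 6"
  shows sample_lower: "\<gamma> * p \<ge> \<gamma> / 2 * r + \<gamma>\<^sup>2 / 2 * (c * (norm a)\<^sup>2) - 3 / 2 * \<gamma>\<^sup>2 * (norm f)\<^sup>2" (is ?lower)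
    and sample_second_moment: "\<gamma>\<^sup>2 * (norm g)\<^sup>2 \<le> 4 * (\<gamma> * p) - 2 * \<gamma> * r + 6 * \<gamma>\<^sup>2 * (norm f)\<^sup>2" (is ?second)
    and sample_lower_doubled: "2 * (\<gamma> * p) \<ge> \<gamma> * r + \<gamma>\<^sup>2 / 2 * (c * (norm a)\<^sup>2) - 3 / 2 * \<gamma>\<^sup>2 * (norm f)\<^sup>2" (is ?doubled)
proof -
  define t m where "t = \<gamma> * L" and "m = \<bar>\<mu>\<bar> * \<gamma>"
  have t: "0 \<le> t" "t \<le> 1 / 6"
    using \<gamma> mu by (auto simp: t_def m_def)
  have "m \<le> t"
    using mu \<gamma>(1) by (simp add: t_def m_def mult.commute)
  with t(2) have m_le: "m \<le> 1 / 6" by simp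
  have t2: "t\<^sup>2 \<le> 1 / 36"
    using power_mono[OF t(2) t(1), of 2] by (simp add: power2_eq_square)
  have c: "c = 1 - 4 * m - 2 * t\<^sup>2"
    by (simp add: c_def m_def t_def power_mult_distrib algebra_simps)
  define N where "N = (norm a)\<^sup>2"
  have N0: "0 \<le> N" by (simp add: N_def)
  have "dist (H (y - \<gamma> *\<^sub>R H y)) (H y) \<le> L * dist (y - \<gamma> *\<^sub>R H y) y"
    using lip by (rule lipschitz_onD) auto
  hence ga: "norm (g - a) \<le> t * norm a"
    using \<gamma>(1) by (simp add: dist_norm g_def a_def t_def mult.commute mult.left_commute)
  have ga2: "(norm (g - a))\<^sup>2 \<le> t\<^sup>2 * N"
    using power_mono[OF ga norm_ge_zero, of 2] by (simp add: power_mult_distrib N_def)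
  have gdota: "2 * (g \<bullet> a) \<ge> (norm g)\<^sup>2 + N - t\<^sup>2 * N"
  proof -
    have "(norm (g - a))\<^sup>2 = (norm g)\<^sup>2 + N - 2 * (g \<bullet> a)"
      by (simp add: N_def power2_norm_eq_inner inner_diff inner_commute)
    thus ?thesis using ga2 by simp
  qed
  have tri: "norm a \<le> norm g + t * norm a"
    using norm_triangle_ineq4[of g "g - a"] ga by simp
  \<comment> \<open>Since \<open>t \<le> 1/6\<close>, extrapolation shrinks the operator at most by the factor \<open>5/6\<close>.\<close>
  have gN: "(norm g)\<^sup>2 \<ge> 25 / 36 * N"
  proof -
    have "5 / 6 * norm a \<le> norm g"
      using tri mult_right_mono[OF t(2) norm_ge_zero[of a]] by simp
    from power_mono[OF this, of 2] show ?thesis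
      by (simp add: N_def power_mult_distrib power2_eq_square)
  qed
  have gN': "N / 2 \<le> (norm g)\<^sup>2 + t\<^sup>2 * N"
  proof -
    have "N \<le> (norm g + t * norm a)\<^sup>2"
      unfolding N_def using tri by (rule power_mono) simp
    also have "\<dots> \<le> 2 * (norm g)\<^sup>2 + 2 * (t * norm a)\<^sup>2"
      using zero_le_power2[of "norm g - t * norm a"] by (simp add: power2_sum power2_diff)
    finally show ?thesis by (simp add: power_mult_distrib N_def)
  qed
  \<comment> \<open>Young's inequality, from expanding the square of \<open>s a - f\<close>.\<close>
  have young: "2 * (f \<bullet> a) \<le> s * N + (norm f)\<^sup>2 / s" if "s > 0" for s
  proof -
    have "0 \<le> (norm (s *\<^sub>R a - f))\<^sup>2" by simp
    also have "\<dots> = s * (s * N + (norm f)\<^sup>2 / s - 2 * (f \<bullet> a))"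
      using that by (simp add: N_def power2_norm_eq_inner inner_diff inner_commute algebra_simps)
    finally show ?thesis using that by (simp add: zero_le_mult_iff)
  qed
  have p: "\<gamma> * p \<ge> \<gamma> / 2 * r + \<gamma>\<^sup>2 * ((norm g)\<^sup>2 / 2 + N / 2 - 2 * (m * N) - t\<^sup>2 * N / 2 - f \<bullet> a)"
  proof -
    define z where "z = y - \<gamma> *\<^sub>R a"
    define q where "q = (g - f) \<bullet> (z - xs)"
    have "r / 2 - 2 * \<bar>\<mu>\<bar> * (\<gamma>\<^sup>2 * N) \<le> q"
      using quasi_monotone_shift[OF quasi[of z], of y \<gamma> a]
      by (simp add: r_def N_def g_def a_def f_def z_def q_def)
    hence "\<gamma> * (r / 2 - 2 * \<bar>\<mu>\<bar> * (\<gamma>\<^sup>2 * N)) \<le> \<gamma> * q"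
      using \<gamma>(1) by (intro mult_left_mono) auto
    also have "\<gamma> * (r / 2 - 2 * \<bar>\<mu>\<bar> * (\<gamma>\<^sup>2 * N)) = \<gamma> / 2 * r - \<gamma>\<^sup>2 * (2 * m * N)"
      by (simp add: m_def right_diff_distrib)
    finally have "\<gamma> / 2 * r - \<gamma>\<^sup>2 * (2 * m * N) \<le> \<gamma> * q" .
    moreover have "\<gamma> * p = \<gamma> * q + \<gamma>\<^sup>2 * (g \<bullet> a) - \<gamma>\<^sup>2 * (f \<bullet> a)"
      by (simp add: p_def q_def z_def inner_diff_left inner_diff_right algebra_simps power2_eq_square)
    moreover have "\<gamma>\<^sup>2 * (((norm g)\<^sup>2 + N - t\<^sup>2 * N) / 2) \<le> \<gamma>\<^sup>2 * (g \<bullet> a)"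
      using gdota by (intro mult_left_mono) auto
    moreover have "\<gamma>\<^sup>2 * ((norm g)\<^sup>2 / 2 + N / 2 - 2 * (m * N) - t\<^sup>2 * N / 2 - f \<bullet> a)
        = \<gamma>\<^sup>2 * (((norm g)\<^sup>2 + N - t\<^sup>2 * N) / 2) - \<gamma>\<^sup>2 * (2 * m * N) - \<gamma>\<^sup>2 * (f \<bullet> a)"
      by (simp add: field_simps)
    ultimately show ?thesis by linarith
  qed
  have mN: "m * N \<le> 1 / 6 * N"
    by (rule mult_right_mono[OF m_le N0])
  have tN: "t\<^sup>2 * N \<le> 1 / 36 * N"
    by (rule mult_right_mono[OF t2 N0])
  have cN: "\<gamma>\<^sup>2 / 2 * (c * (norm a)\<^sup>2) = \<gamma>\<^sup>2 * (N / 2 - 2 * (m * N) - t\<^sup>2 * N)"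
    by (simp add: c N_def field_simps)
  have f0: "0 \<le> (norm f)\<^sup>2" by simp
  \<comment> \<open>With \<open>m, t \<le> 1/6\<close> and \<open>gN\<close>, the available multiples of \<open>N\<close> are \<open>1/4\<close> against a need of \<open>1/4\<close>
    (lower bound, through \<open>gN'\<close>), \<open>47/36\<close> against \<open>1\<close> (second moment) and \<open>31/36\<close> against \<open>2/3\<close>
    (doubled bound); in the last case the noise \<open>3/2\<close> is met exactly.\<close>
  have young_half: "2 * (f \<bullet> a) \<le> N / 2 + 2 * (norm f)\<^sup>2"
    using young[of "1 / 2"] by simp
  have young_two_thirds: "2 * (f \<bullet> a) \<le> 2 / 3 * N + 3 / 2 * (norm f)\<^sup>2"
    using young[of "2 / 3"] by simp
  have "0 \<le> \<gamma>\<^sup>2 * ((norm g)\<^sup>2 / 2 + t\<^sup>2 * N / 2 - f \<bullet> a + 3 / 2 * (norm f)\<^sup>2)"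
    using gN' young_half f0 by (intro mult_nonneg_nonneg zero_le_power2) linarith
  with p show ?lower unfolding cN by (simp add: algebra_simps)
  have "0 \<le> \<gamma>\<^sup>2 * ((norm g)\<^sup>2 + 2 * N - 8 * (m * N) - 2 * (t\<^sup>2 * N) - 4 * (f \<bullet> a) + 6 * (norm f)\<^sup>2)"
    using gN mN tN N0 young_half f0 by (intro mult_nonneg_nonneg zero_le_power2) linarith
  with p show ?second by (simp add: algebra_simps)
  have "0 \<le> \<gamma>\<^sup>2 * ((norm g)\<^sup>2 + N / 2 - 2 * (m * N) - 2 * (f \<bullet> a) + 3 / 2 * (norm f)\<^sup>2)"
    using gN mN N0 young_two_thirds by (intro mult_nonneg_nonneg zero_le_power2) linarith
  with p show ?doubled unfolding cN by (simp add: algebra_simps)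
qed

section \<open>Averages over batches\<close>

lemma finite_batches: "finite (batches n b)"
  by (rule finite_subset[of _ "Pow {1..n}"]) (auto simp: batches_def)

lemma card_batches: "card (batches n b) = n choose b"
  using n_subsets[of "{1..n}" b] by (simp add: batches_def)

lemma batch_mean_add: "batch_mean n b (\<lambda>S. h S + h' S) = batch_mean n b h + batch_mean n b h'"
  by (simp add: batch_mean_def sum.distrib distrib_left)

lemma batch_mean_diff: "batch_mean n b (\<lambda>S. h S - h' S) = batch_mean n b h - batch_mean n b h'"
  by (simp add: batch_mean_def sum_subtractf right_diff_distrib)

lemma batch_mean_cmult: "batch_mean n b (\<lambda>S. c * h S) = c * batch_mean n b h"
  by (simp add: batch_mean_def sum_distrib_left[symmetric])

lemma batch_mean_multc: "batch_mean n b (\<lambda>S. h S * c) = batch_mean n b h * c"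
  by (simp add: batch_mean_def sum_distrib_right[symmetric])

lemma batch_mean_const: "b \<le> n \<Longrightarrow> batch_mean n b (\<lambda>S. c) = c"
  by (simp add: batch_mean_def card_batches)

lemma batch_mean_mono:
  "(\<And>S. S \<in> batches n b \<Longrightarrow> h S \<le> h' S) \<Longrightarrow> batch_mean n b h \<le> batch_mean n b h'"
  unfolding batch_mean_def by (intro mult_left_mono sum_mono) auto

lemma mu_nice_eq_batch_mean:
  "mu_nice n b \<mu> = batch_mean n b (\<lambda>S. if \<mu> S \<ge> 0 then \<mu> S else 4 * \<mu> S)"
proof -
  have "batches n b \<inter> {S. \<mu> S \<ge> 0} = {S \<in> batches n b. \<mu> S \<ge> 0}"
    and "batches n b \<inter> - {S. \<mu> S \<ge> 0} = {S \<in> batches n b. \<mu> S < 0}"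
    by auto
  thus ?thesis
    unfolding mu_nice_def batch_mean_def sum.If_cases[OF finite_batches] by (simp only: sum_distrib_left)
qed

lemma card_batches_containing:
  assumes "i \<in> {1..n}" "1 \<le> b"
  shows "card {S \<in> batches n b. i \<in> S} = (n - 1) choose (b - 1)"
proof -
  have "bij_betw (insert i) {T. T \<subseteq> {1..n} - {i} \<and> card T = b - 1} {S \<in> batches n b. i \<in> S}"
  proof (rule bij_betw_byWitness[where f' = "\<lambda>S. S - {i}"])
    have "card (insert i T) = b" if "T \<subseteq> {1..n} - {i}" "card T = b - 1" for T
      using that assms by (subst card_insert_disjoint) (auto intro: finite_subset)
    thus "insert i ` {T. T \<subseteq> {1..n} - {i} \<and> card T = b - 1} \<subseteq> {S \<in> batches n b. i \<in> S}"
      using assms by (auto simp: batches_def)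
    have "card (S - {i}) = b - 1" if "S \<in> batches n b" "i \<in> S" for S
      using that by (auto simp: batches_def card_Diff_singleton)
    thus "(\<lambda>S. S - {i}) ` {S \<in> batches n b. i \<in> S} \<subseteq> {T. T \<subseteq> {1..n} - {i} \<and> card T = b - 1}"
      by (auto simp: batches_def)
  qed auto
  from bij_betw_same_card[OF this] show ?thesis
    using n_subsets[of "{1..n} - {i}" "b - 1"] assms by (simp add: card_Diff_singleton)
qed

text \<open>Double counting: every index lies in the same number of batches, so the sum over all batches is a
  multiple of \<open>F(x\<^sup>*)\<close>.\<close>

lemma sum_batches_avg_op_eq_0:
  assumes b: "b \<in> {1..n}" and zero: "avg_op F {1..n} xs = 0"
  shows "(\<Sum>S\<in>batches n b. avg_op F S xs) = 0"
proof -
  have "(\<Sum>S\<in>batches n b. \<Sum>i\<in>S. F i xs) = (\<Sum>S\<in>batches n b. \<Sum>i\<in>{i \<in> {1..n}. i \<in> S}. F i xs)"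
    by (intro sum.cong refl) (auto simp: batches_def)
  also have "\<dots> = (\<Sum>i\<in>{1..n}. \<Sum>S\<in>{S \<in> batches n b. i \<in> S}. F i xs)"
    by (rule sum.swap_restrict[OF finite_batches finite_atLeastAtMost])
  also have "\<dots> = (\<Sum>i\<in>{1..n}. real ((n - 1) choose (b - 1)) *\<^sub>R F i xs)"
    using b by (intro sum.cong refl) (simp add: sum_constant_scaleR card_batches_containing)
  also have "\<dots> = 0"
    using zero b by (simp add: scaleR_sum_right[symmetric] avg_op_def)
  finally have "(\<Sum>S\<in>batches n b. \<Sum>i\<in>S. F i xs) = 0" .
  moreover have "(\<Sum>S\<in>batches n b. avg_op F S xs)
      = (\<Sum>S\<in>batches n b. (1 / real b) *\<^sub>R (\<Sum>i\<in>S. F i xs))"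
    by (intro sum.cong refl) (simp add: avg_op_def batches_def)
  ultimately show ?thesis by (simp add: scaleR_sum_right[symmetric])
qed

section \<open>Averaged inequalities\<close>

text \<open>The averages \<open>progress\<close> and \<open>energy\<close> are formed with \<open>\<gamma>\<close> in place of the step size \<open>\<alpha>\<gamma>\<close> of the
  update, so that the dependence on \<open>\<alpha>\<close> stays explicit.\<close>

locale nice_extragradient =
  fixes H :: "nat set \<Rightarrow> 'a::real_inner \<Rightarrow> 'a" and xs :: 'a and n b :: nat
    and L \<mu> :: "nat set \<Rightarrow> real" and \<gamma> :: real
  assumes b_le: "b \<le> n"
    and lipschitz: "\<And>S. S \<in> batches n b \<Longrightarrow> (L S)-lipschitz_on UNIV (H S)"
    and quasi_monotone:
      "\<And>S y. S \<in> batches n b \<Longrightarrow> (H S y - H S xs) \<bullet> (y - xs) \<ge> \<mu> S * (norm (y - xs))\<^sup>2"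
    and abs_mu_le: "\<And>S. S \<in> batches n b \<Longrightarrow> \<bar>\<mu> S\<bar> \<le> L S"
    and step_pos: "0 < \<gamma>"
    and step_le: "\<And>S. S \<in> batches n b \<Longrightarrow> \<gamma> * L S \<le> 1 / 6"
    and sum_solution: "(\<Sum>S\<in>batches n b. H S xs) = 0"
    and mu_nice_nonneg: "mu_nice n b \<mu> \<ge> 0"
begin

definition dir :: "nat set \<Rightarrow> 'a \<Rightarrow> 'a" where
  "dir S y = H S (y - \<gamma> *\<^sub>R H S y)"

definition weight :: "nat set \<Rightarrow> real" where
  "weight S = (if \<mu> S \<ge> 0 then \<mu> S else 4 * \<mu> S)"

definition coeff :: "nat set \<Rightarrow> real" where
  "coeff S = 1 - 4 * \<bar>\<mu> S\<bar> * \<gamma> - 2 * (L S)\<^sup>2 * \<gamma>\<^sup>2"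

definition gap :: "'a \<Rightarrow> real" where
  "gap y = batch_mean n b (\<lambda>S. coeff S * (norm (H S y))\<^sup>2)"

definition noise :: real where
  "noise = batch_mean n b (\<lambda>S. (norm (H S xs))\<^sup>2)"

definition progress :: "'a \<Rightarrow> real" where
  "progress y = batch_mean n b (\<lambda>S. \<gamma> * (dir S y \<bullet> (y - xs)))"

definition energy :: "'a \<Rightarrow> real" where
  "energy y = batch_mean n b (\<lambda>S. \<gamma>\<^sup>2 * (norm (dir S y))\<^sup>2)"

lemma mean_weight: "batch_mean n b weight = mu_nice n b \<mu>"
  unfolding mu_nice_eq_batch_mean weight_def[abs_def] ..

lemma noise_nonneg: "0 \<le> noise"
  by (simp add: noise_def batch_mean_def sum_nonneg)

lemma gap_nonneg: "0 \<le> gap y"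
proof -
  have "0 \<le> coeff S" if S: "S \<in> batches n b" for S
  proof -
    have "\<gamma> * \<bar>\<mu> S\<bar> \<le> \<gamma> * L S"
      using abs_mu_le[OF S] step_pos by (intro mult_left_mono) auto
    hence "\<bar>\<mu> S\<bar> * \<gamma> \<le> 1 / 6"
      using step_le[OF S] by (subst mult.commute) linarith
    moreover have "(L S)\<^sup>2 * \<gamma>\<^sup>2 \<le> (1 / 6)\<^sup>2"
      using power_mono[OF step_le[OF S], of 2] step_pos abs_mu_le[OF S]
      by (simp add: power_mult_distrib mult.commute)
    ultimately show ?thesis by (simp add: coeff_def power2_eq_square)
  qed
  thus ?thesis by (simp add: gap_def batch_mean_def sum_nonneg)
qed

lemma step_mu_nice_le: "\<gamma> * mu_nice n b \<mu> \<le> 1 / 6"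
proof -
  have "\<gamma> * weight S \<le> 1 / 6" if S: "S \<in> batches n b" for S
  proof -
    have "weight S \<le> L S" using abs_mu_le[OF S] by (auto simp: weight_def)
    hence "\<gamma> * weight S \<le> \<gamma> * L S"
      using step_pos by (intro mult_left_mono) auto
    also have "\<dots> \<le> 1 / 6" by (rule step_le[OF S])
    finally show ?thesis .
  qed
  hence "batch_mean n b (\<lambda>S. \<gamma> * weight S) \<le> batch_mean n b (\<lambda>S. 1 / 6)"
    by (rule batch_mean_mono)
  thus ?thesis
    by (simp add: batch_mean_cmult batch_mean_const[OF b_le] mean_weight)
qed

text \<open>Subtracting \<open>F\<^sub>S(x\<^sup>*)\<close> is free on average although it is not for a single batch. This brings the
  mean inner product into the form to which quasi-strong monotonicity applies.\<close>

lemma progress_centered: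
  "progress y = batch_mean n b (\<lambda>S. \<gamma> * ((dir S y - H S xs) \<bullet> (y - xs)))"
proof -
  have "batch_mean n b (\<lambda>S. H S xs \<bullet> (y - xs)) = 0"
    unfolding batch_mean_def inner_sum_left[symmetric] sum_solution by simp
  thus ?thesis
    unfolding progress_def inner_diff_left batch_mean_cmult batch_mean_diff by simp
qed

lemma progress_lower:
  "progress y \<ge> \<gamma> * mu_nice n b \<mu> / 2 * (norm (y - xs))\<^sup>2 + \<gamma>\<^sup>2 / 2 * gap y - 3 / 2 * \<gamma>\<^sup>2 * noise"
proof -
  have "batch_mean n b (\<lambda>S. \<gamma> / 2 * (weight S * (norm (y - xs))\<^sup>2)
      + \<gamma>\<^sup>2 / 2 * (coeff S * (norm (H S y))\<^sup>2) - 3 / 2 * \<gamma>\<^sup>2 * (norm (H S xs))\<^sup>2) \<le> progress y"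
    unfolding progress_centered dir_def coeff_def weight_def
    by (rule batch_mean_mono)
      (rule sample_lower[OF lipschitz quasi_monotone abs_mu_le step_pos step_le])
  thus ?thesis
    unfolding batch_mean_add batch_mean_diff batch_mean_cmult batch_mean_multc mean_weight
      gap_def[symmetric] noise_def[symmetric] by simp
qed

text \<open>Batches with negative \<open>\<mu>\<^sub>S\<close> spoil this bound individually; the offending terms add up to a
  multiple of the averaged \<open>\<mu>\<close>, which is non-negative.\<close>

lemma energy_le_progress: "energy y \<le> 4 * progress y + 6 * \<gamma>\<^sup>2 * noise"
proof -
  have "energy y \<le> batch_mean n b (\<lambda>S. 4 * (\<gamma> * ((dir S y - H S xs) \<bullet> (y - xs)))
      - 2 * \<gamma> * (weight S * (norm (y - xs))\<^sup>2) + 6 * \<gamma>\<^sup>2 * (norm (H S xs))\<^sup>2)"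
    unfolding energy_def dir_def weight_def
    by (rule batch_mean_mono)
      (rule sample_second_moment[OF lipschitz quasi_monotone abs_mu_le step_pos step_le])
  hence "energy y \<le> 4 * progress y - 2 * \<gamma> * (mu_nice n b \<mu> * (norm (y - xs))\<^sup>2) + 6 * \<gamma>\<^sup>2 * noise"
    by (simp add: progress_centered noise_def mean_weight[symmetric] batch_mean_add batch_mean_diff
        batch_mean_cmult batch_mean_multc)
  moreover have "0 \<le> \<gamma> * (mu_nice n b \<mu> * (norm (y - xs))\<^sup>2)"
    using step_pos mu_nice_nonneg by simp
  ultimately show ?thesis by simp
qed

text \<open>Compared with twice \<open>progress_lower\<close>, this gives up half of the gain and saves half of the noise.
  It is what makes up for a possibly negative \<open>progress\<close> in the analysis of one step.\<close>

lemma double_progress_lower: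
  "2 * progress y
     \<ge> \<gamma> * mu_nice n b \<mu> / 2 * (norm (y - xs))\<^sup>2 + \<gamma>\<^sup>2 / 2 * gap y - 3 / 2 * \<gamma>\<^sup>2 * noise"
proof -
  have "batch_mean n b (\<lambda>S. \<gamma> * (weight S * (norm (y - xs))\<^sup>2)
      + \<gamma>\<^sup>2 / 2 * (coeff S * (norm (H S y))\<^sup>2) - 3 / 2 * \<gamma>\<^sup>2 * (norm (H S xs))\<^sup>2) 
      \<le> batch_mean n b (\<lambda>S. 2 * (\<gamma> * ((dir S y - H S xs) \<bullet> (y - xs))))"
    unfolding dir_def coeff_def weight_def
    by (rule batch_mean_mono)
      (rule sample_lower_doubled[OF lipschitz quasi_monotone abs_mu_le step_pos step_le])
  hence "\<gamma> * (mu_nice n b \<mu> * (norm (y - xs))\<^sup>2) + \<gamma>\<^sup>2 / 2 * gap y - 3 / 2 * \<gamma>\<^sup>2 * noise \<le> 2 * progress y"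
    unfolding batch_mean_add batch_mean_diff batch_mean_cmult batch_mean_multc mean_weight
      gap_def[symmetric] noise_def[symmetric] progress_centered by simp
  moreover have "0 \<le> \<gamma> * (mu_nice n b \<mu> * (norm (y - xs))\<^sup>2)"
    using step_pos mu_nice_nonneg by simp
  ultimately show ?thesis by (simp add: algebra_simps)
qed

text \<open>The slack in this inequality, divided by \<open>\<alpha>\<close>, is affine in \<open>\<alpha>\<close>, so it suffices to check the end points
  \<open>\<alpha> = 0\<close> and \<open>\<alpha> = 1/4\<close>.\<close>

lemma mean_step_le:
  assumes "0 < \<alpha>" "\<alpha> \<le> 1 / 4"
  shows "batch_mean n b (\<lambda>S. (norm (y - (\<alpha> * \<gamma>) *\<^sub>R dir S y - xs))\<^sup>2)
    \<le> (1 - \<alpha> * \<gamma> * mu_nice n b \<mu> / 2) * (norm (y - xs))\<^sup>2 - \<alpha> * \<gamma>\<^sup>2 / 2 * gap y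
      + 3 * \<alpha> / 2 * (4 * \<alpha> + 1) * \<gamma>\<^sup>2 * noise"
proof -
  define R where "R = \<gamma> * mu_nice n b \<mu> / 2 * (norm (y - xs))\<^sup>2 + \<gamma>\<^sup>2 / 2 * gap y"
  define s where "s = \<gamma>\<^sup>2 * noise"
  have "(norm (y - (\<alpha> * \<gamma>) *\<^sub>R dir S y - xs))\<^sup>2
      = (norm (y - xs))\<^sup>2 - 2 * \<alpha> * (\<gamma> * (dir S y \<bullet> (y - xs))) + \<alpha>\<^sup>2 * (\<gamma>\<^sup>2 * (norm (dir S y))\<^sup>2)" for S
  proof -
    have "y - (\<alpha> * \<gamma>) *\<^sub>R dir S y - xs = (y - xs) - (\<alpha> * \<gamma>) *\<^sub>R dir S y" by simp
    thus ?thesis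
      by (simp only: power2_norm_eq_inner) (simp add: inner_diff_left inner_diff_right inner_commute power2_eq_square algebra_simps)
  qed
  hence mean: "batch_mean n b (\<lambda>S. (norm (y - (\<alpha> * \<gamma>) *\<^sub>R dir S y - xs))\<^sup>2)
      = (norm (y - xs))\<^sup>2 - 2 * \<alpha> * progress y + \<alpha>\<^sup>2 * energy y"
    by (simp add: batch_mean_add batch_mean_diff batch_mean_cmult batch_mean_const[OF b_le]
        progress_def energy_def)
  have zero: "R - 2 * progress y - 3 / 2 * s \<le> 0"
    using double_progress_lower[of y] by (simp add: R_def s_def)
  have quarter: "R - 2 * progress y + energy y / 4 - 3 * s \<le> 0"
    using progress_lower[of y] energy_le_progress[of y] by (simp add: R_def s_def)
  have "R - 2 * progress y + \<alpha> * energy y - 3 / 2 * s - 6 * \<alpha> * s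
      = (1 - 4 * \<alpha>) * (R - 2 * progress y - 3 / 2 * s)
        + 4 * \<alpha> * (R - 2 * progress y + energy y / 4 - 3 * s)"
    by (simp add: field_simps)
  also have "\<dots> \<le> 0"
    using assms zero quarter by (intro add_nonpos_nonpos mult_nonneg_nonpos) auto
  finally have "\<alpha> * (R - 2 * progress y + \<alpha> * energy y - 3 / 2 * s - 6 * \<alpha> * s) \<le> 0"
    using assms(1) by (simp add: mult_nonneg_nonpos)
  thus ?thesis
    unfolding mean
    by (simp add: R_def s_def algebra_simps add_divide_distrib power2_eq_square)
qed

end

section \<open>Conditioning on the current iterate\<close>

lemma simple_function_count_space:
  assumes "X \<in> measurable N (count_space B)" "finite B"
  shows "simple_function N X"
  unfolding simple_function_def
proof (intro conjI ballI)
  have sub: "X ` space N \<subseteq> B" using measurable_space[OF assms(1)] by auto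
  thus "finite (X ` space N)" using assms(2) by (rule finite_subset)
  fix x assume "x \<in> X ` space N"
  hence "{x} \<in> sets (count_space B)" using sub by auto
  with assms(1) show "X -` {x} \<inter> space N \<in> sets N" by (rule measurable_sets)
qed

lemma (in finite_measure) integrable_simple:
  fixes f :: "'a \<Rightarrow> real"
  assumes "simple_function M f"
  shows "integrable M f"
  by (rule integrable_simple_function[OF assms]) (simp add: emeasure_eq_measure)

lemma sseg_cong:
  assumes "\<And>i. i < k \<Longrightarrow> \<xi> i \<omega> = \<eta> i \<omega>'"
  shows "sseg Fs \<gamma>1 \<gamma>2 \<xi> x0 k \<omega> = sseg Fs \<gamma>1 \<gamma>2 \<eta> x0 k \<omega>'"
  using assms by (induction k) auto

text \<open>Working with simple functions yields measurability and integrability of every function of the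
  iterate at once.\<close>

lemma simple_function_sseg:
  assumes "\<And>i. i < k \<Longrightarrow> simple_function N (\<xi> i)"
  shows "simple_function N (sseg Fs \<gamma>1 \<gamma>2 \<xi> x0 k)"
  using assms
proof (induction k)
  case 0
  have "sseg Fs \<gamma>1 \<gamma>2 \<xi> x0 0 = (\<lambda>_. x0)" by (simp add: fun_eq_iff)
  thus ?case by simp
next
  case (Suc k)
  have "simple_function N (\<lambda>\<omega>. (\<lambda>s y. y - \<gamma>2 s *\<^sub>R sseg_dir Fs \<gamma>1 s y) (\<xi> k \<omega>) (sseg Fs \<gamma>1 \<gamma>2 \<xi> x0 k \<omega>))"
    by (rule simple_function_compose2) (use Suc in auto)
  moreover have "sseg Fs \<gamma>1 \<gamma>2 \<xi> x0 (Suc k)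
      = (\<lambda>\<omega>. (\<lambda>s y. y - \<gamma>2 s *\<^sub>R sseg_dir Fs \<gamma>1 s y) (\<xi> k \<omega>) (sseg Fs \<gamma>1 \<gamma>2 \<xi> x0 k \<omega>))"
    by (simp add: fun_eq_iff)
  ultimately show ?case by simp
qed

lemma (in prob_space) uniform_indicator_expectation:
  assumes meas: "X \<in> measurable M (count_space B)" and fin: "finite B"
    and unif: "distr M (count_space B) X = uniform_count_measure B" and S: "S \<in> B"
  shows "(\<integral>\<omega>. indicator {S} (X \<omega>) \<partial>M) = 1 / real (card B)"
proof -
  have "(\<integral>\<omega>. indicator {S} (X \<omega>) \<partial>M) = (\<integral>s. (indicator {S} s :: real) \<partial>distr M (count_space B) X)"
    by (rule integral_distr[symmetric, OF meas]) simp
  also have "\<dots> = (\<Sum>s\<in>B. indicator {S} s) / real (card B)"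
    unfolding unif by (rule integral_uniform_count_measure[OF fin])
  also have "(\<Sum>s\<in>B. indicator {S} s) = (1 :: real)"
    using fin S by (simp add: indicator_def sum.delta')
  finally show ?thesis .
qed

locale uniform_sampling = prob_space M for M :: "'w measure" +
  fixes B :: "'s set" and \<xi> :: "nat \<Rightarrow> 'w \<Rightarrow> 's"
  assumes indep: "indep_vars (\<lambda>_. count_space B) \<xi> UNIV" and fin: "finite B"
    and unif: "\<And>k. distr M (count_space B) (\<xi> k) = uniform_count_measure B"
begin

lemma meas_\<xi>: "\<xi> i \<in> measurable M (count_space B)"
  using indep by (auto simp: indep_vars_def2)

lemma simple_\<xi>: "simple_function M (\<xi> i)"
  by (rule simple_function_count_space[OF meas_\<xi> fin])

lemma \<xi>_in: "\<omega> \<in> space M \<Longrightarrow> \<xi> i \<omega> \<in> B"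
  using measurable_space[OF meas_\<xi>] by simp

lemma simple_iterate: "simple_function M (sseg Fs \<gamma>1 \<gamma>2 \<xi> x0 k)"
  by (rule simple_function_sseg) (rule simple_\<xi>)

text \<open>The iterate \<open>x\<^sup>k\<close> is recomputed from the restriction of the sample sequence to \<open>{..<k}\<close>, which makes
  its independence of \<open>\<xi>\<^sub>k\<close> an instance of the independence of disjoint blocks. A joint function
  is then split according to the finitely many values of \<open>\<xi>\<^sub>k\<close>.\<close>

lemma fresh_sample_expectation:
  fixes h :: "'s \<Rightarrow> 'b::real_vector \<Rightarrow> real" and Fs :: "'s \<Rightarrow> 'b \<Rightarrow> 'b" and \<gamma>1 \<gamma>2 :: "'s \<Rightarrow> real" and x0 :: 'b and k :: nat
  defines "X \<equiv> sseg Fs \<gamma>1 \<gamma>2 \<xi> x0 k"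
  shows "(\<integral>\<omega>. h (\<xi> k \<omega>) (X \<omega>) \<partial>M) = (\<integral>\<omega>. 1 / real (card B) * (\<Sum>S\<in>B. h S (X \<omega>)) \<partial>M)"
proof -
  have simple_X: "simple_function M X"
    unfolding X_def by (rule simple_iterate)
  have int_h: "integrable M (\<lambda>\<omega>. h S (X \<omega>))" for S
    by (rule integrable_simple) (rule simple_function_compose1[OF simple_X])
  have int_ind: "integrable M (\<lambda>\<omega>. indicator {S} (\<xi> k \<omega>) :: real)" for S
    by (rule integrable_simple) (rule simple_function_compose1[OF simple_\<xi>])
  have prod: "(\<integral>\<omega>. indicator {S} (\<xi> k \<omega>) * h S (X \<omega>) \<partial>M) = 1 / real (card B) * (\<integral>\<omega>. h S (X \<omega>) \<partial>M)"
      and int_prod: "integrable M (\<lambda>\<omega>. indicator {S} (\<xi> k \<omega>) * h S (X \<omega>))" if S: "S \<in> B" for S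
  proof -
    let ?P = "\<lambda>I. PiM I (\<lambda>_::nat. count_space B)"
    let ?past = "\<lambda>\<omega>. restrict (\<lambda>i. \<xi> i \<omega>) {..<k}" and ?now = "\<lambda>\<omega>. restrict (\<lambda>i. \<xi> i \<omega>) {k}"
    have ind: "indep_var (?P {k}) ?now (?P {..<k}) ?past"
      by (rule indep_var_restrict[OF indep]) auto
    have now: "(\<lambda>f. indicator {S} (f k) :: real) \<in> borel_measurable (?P {k})"
      by (rule measurable_compose[where N = "count_space B"]) (auto intro: measurable_component_singleton)
    have "simple_function (?P {..<k}) (sseg Fs \<gamma>1 \<gamma>2 (\<lambda>i f. f i) x0 k)"
      by (rule simple_function_sseg, rule simple_function_count_space[OF _ fin])
        (auto intro: measurable_component_singleton)
    hence past: "(\<lambda>f. h S (sseg Fs \<gamma>1 \<gamma>2 (\<lambda>i f. f i) x0 k f)) \<in> borel_measurable (?P {..<k})"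
      by (intro borel_measurable_simple_function simple_function_compose1[where g = "h S"])
    have X: "sseg Fs \<gamma>1 \<gamma>2 (\<lambda>i f. f i) x0 k (?past \<omega>) = X \<omega>" for \<omega>
      unfolding X_def by (rule sseg_cong) simp
    have "indep_var borel (\<lambda>\<omega>. indicator {S} (\<xi> k \<omega>) :: real) borel (\<lambda>\<omega>. h S (X \<omega>))"
      using indep_var_compose[OF ind now past] by (simp add: comp_def X)
    from indep_var_lebesgue_integral[OF this int_ind int_h] indep_var_integrable[OF this int_ind int_h]
    show "(\<integral>\<omega>. indicator {S} (\<xi> k \<omega>) * h S (X \<omega>) \<partial>M) = 1 / real (card B) * (\<integral>\<omega>. h S (X \<omega>) \<partial>M)"
      and "integrable M (\<lambda>\<omega>. indicator {S} (\<xi> k \<omega>) * h S (X \<omega>))"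
      by (simp_all add: uniform_indicator_expectation[OF meas_\<xi> fin unif S])
  qed
  have "(\<integral>\<omega>. h (\<xi> k \<omega>) (X \<omega>) \<partial>M) = (\<integral>\<omega>. (\<Sum>S\<in>B. indicator {S} (\<xi> k \<omega>) * h S (X \<omega>)) \<partial>M)"
  proof (rule Bochner_Integration.integral_cong[OF refl])
    fix \<omega> assume "\<omega> \<in> space M"
    hence "\<xi> k \<omega> \<in> B" by (rule \<xi>_in)
    have "(\<Sum>S\<in>B. indicator {S} (\<xi> k \<omega>) * h S (X \<omega>)) = (\<Sum>S\<in>B. if S = \<xi> k \<omega> then h S (X \<omega>) else 0)"
      by (intro sum.cong) (auto simp: indicator_def)
    with \<open>\<xi> k \<omega> \<in> B\<close> show "h (\<xi> k \<omega>) (X \<omega>) = (\<Sum>S\<in>B. indicator {S} (\<xi> k \<omega>) * h S (X \<omega>))"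
      using fin by simp
  qed
  also have "\<dots> = (\<Sum>S\<in>B. 1 / real (card B) * (\<integral>\<omega>. h S (X \<omega>) \<partial>M))"
    by (subst Bochner_Integration.integral_sum) (auto intro: int_prod simp: prod)
  also have "\<dots> = (\<integral>\<omega>. (\<Sum>S\<in>B. 1 / real (card B) * h S (X \<omega>)) \<partial>M)"
    by (subst Bochner_Integration.integral_sum) (auto intro: int_h)
  finally show ?thesis by (simp add: sum_distrib_left)
qed

text \<open>Events generated by \<open>x\<^sup>k\<close> have indicators that are functions of \<open>x\<^sup>k\<close>, so they can be
  moved into \<open>h\<close>; the defining property of conditional expectation thereby becomes
  \<open>fresh_sample_expectation\<close>.\<close>

lemma cond_exp_given_fresh_sample:
  fixes h :: "'s \<Rightarrow> 'b::euclidean_space \<Rightarrow> real" and Fs :: "'s \<Rightarrow> 'b \<Rightarrow> 'b" and \<gamma>1 \<gamma>2 :: "'s \<Rightarrow> real" and x0 :: 'b and k :: nat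
  assumes h: "\<And>S. S \<in> B \<Longrightarrow> h S \<in> borel_measurable borel"
  defines "X \<equiv> sseg Fs \<gamma>1 \<gamma>2 \<xi> x0 k"
  shows "AE \<omega> in M. cond_exp_given M X (\<lambda>\<omega>. h (\<xi> k \<omega>) (X \<omega>)) \<omega>
           = 1 / real (card B) * (\<Sum>S\<in>B. h S (X \<omega>))"
proof -
  have simple_X: "simple_function M X"
    unfolding X_def by (rule simple_iterate)
  have X_meas: "X \<in> borel_measurable M"
    using simple_X by (rule borel_measurable_simple_function)
  let ?F = "vimage_algebra (space M) X borel"
  have "subalgebra M ?F"
    unfolding subalgebra_def using X_meas by (auto simp: sets_vimage_algebra2 intro: measurable_sets)
  then interpret finite_measure_subalgebra M ?F by unfold_locales
  have X_F: "X \<in> measurable ?F borel"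
    by (rule measurable_vimage_algebra1) simp
  show ?thesis
    unfolding cond_exp_given_def
  proof (rule real_cond_exp_charact)
    fix A assume "A \<in> sets ?F"
    then obtain T where A: "A = X -` T \<inter> space M"
      by (auto simp: sets_vimage_algebra2)
    have "(\<integral>\<omega>\<in>A. h (\<xi> k \<omega>) (X \<omega>) \<partial>M) = (\<integral>\<omega>. (indicator T (X \<omega>) * h (\<xi> k \<omega>) (X \<omega>)) \<partial>M)"
      unfolding set_lebesgue_integral_def
      by (rule Bochner_Integration.integral_cong) (auto simp: A indicator_def)
    also have "\<dots> = (\<integral>\<omega>. 1 / real (card B) * (\<Sum>S\<in>B. indicator T (X \<omega>) * h S (X \<omega>)) \<partial>M)"
      unfolding X_def
      by (rule fresh_sample_expectation[where h = "\<lambda>S y. indicator T y * h S y"])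
    also have "\<dots> = (\<integral>\<omega>\<in>A. 1 / real (card B) * (\<Sum>S\<in>B. h S (X \<omega>)) \<partial>M)"
      unfolding set_lebesgue_integral_def
      by (rule Bochner_Integration.integral_cong) (auto simp: A indicator_def)
    finally show "(\<integral>\<omega>\<in>A. h (\<xi> k \<omega>) (X \<omega>) \<partial>M) = (\<integral>\<omega>\<in>A. 1 / real (card B) * (\<Sum>S\<in>B. h S (X \<omega>)) \<partial>M)" .
  next
    show "integrable M (\<lambda>\<omega>. h (\<xi> k \<omega>) (X \<omega>))"
      by (rule integrable_simple[OF simple_function_compose2[OF simple_\<xi> simple_X]])
    let ?m = "\<lambda>y. 1 / real (card B) * (\<Sum>S\<in>B. h S y)"
    show "integrable M (\<lambda>\<omega>. ?m (X \<omega>))"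
      by (rule integrable_simple[OF simple_function_compose1[OF simple_X, of ?m]])
    have "?m \<in> borel_measurable borel"
      using h by (intro borel_measurable_times borel_measurable_const borel_measurable_sum) auto
    from measurable_compose[OF X_F this] show "(\<lambda>\<omega>. ?m (X \<omega>)) \<in> borel_measurable ?F" .
  qed
qed

end

section \<open>Recursions and the convergence theorem\<close>

lemma contraction_with_noise:
  fixes E :: "nat \<Rightarrow> real"
  assumes step: "\<And>k. E (Suc k) \<le> (1 - \<rho>) * E k + D" and \<rho>: "0 < \<rho>" "\<rho> \<le> 1"
    and D: "0 \<le> D"
  shows "E K \<le> (1 - \<rho>) ^ K * E 0 + D / \<rho>"
proof (induction K)
  case 0
  show ?case using \<rho> D by simp
next
  case (Suc K)
  have "(1 - \<rho>) * E K \<le> (1 - \<rho>) * ((1 - \<rho>) ^ K * E 0 + D / \<rho>)"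
    using Suc \<rho> by (intro mult_left_mono) auto
  moreover have "(1 - \<rho>) * (D / \<rho>) + D = D / \<rho>"
    using \<rho> by (simp add: field_simps)
  ultimately show ?case
    using step[of K] by (simp add: distrib_left mult.assoc)
qed

lemma telescoped_descent:
  fixes E W :: "nat \<Rightarrow> real"
  assumes step: "\<And>k. E (Suc k) \<le> E k - W k + D" and E: "\<And>k. 0 \<le> E k"
  shows "(\<Sum>k = 0..K. W k) \<le> E 0 + (real K + 1) * D"
proof -
  have "(\<Sum>k = 0..K. W k) + E (Suc K) \<le> E 0 + (real K + 1) * D"
  proof (induction K)
    case 0
    show ?case using step[of 0] by simp
  next
    case (Suc K)
    show ?case using step[of "Suc K"] Suc by (simp add: algebra_simps)
  qed
  thus ?thesis using E[of "Suc K"] by simp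
qed

theorem theoremE3:
  fixes Fi :: "nat \<Rightarrow> real ^ 'd \<Rightarrow> real ^ 'd"
    and xs x0 :: "real ^ 'd"
    and n b :: nat
    and Li \<mu>i :: "nat \<Rightarrow> real"
    and L \<mu> :: "nat set \<Rightarrow> real"
    and \<alpha> \<gamma> :: real
    and \<gamma>1 \<gamma>2 :: "nat set \<Rightarrow> real"
    and M :: "'w measure"
    and \<xi> :: "nat \<Rightarrow> 'w \<Rightarrow> nat set"
    and x g :: "nat \<Rightarrow> 'w \<Rightarrow> real ^ 'd"
    and mubar sigma2 :: real
    and w :: "real ^ 'd \<Rightarrow> real"
  defines "x \<equiv> sseg (avg_op Fi) \<gamma>1 \<gamma>2 \<xi> x0"
    and "g \<equiv> (\<lambda>k \<omega>. sseg_dir (avg_op Fi) \<gamma>1 (\<xi> k \<omega>) (x k \<omega>))"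
    and "mubar \<equiv> mu_nice n b \<mu>"
    and "sigma2 \<equiv> sigma2_nice n b Fi xs"
    and "w \<equiv> (\<lambda>y. batch_mean n b
           (\<lambda>S. (1 - 4 * \<bar>\<mu> S\<bar> * \<gamma> - 2 * (L S)\<^sup>2 * \<gamma>\<^sup>2) * (norm (avg_op Fi S y))\<^sup>2))"
  assumes "b \<in> {1..n}"
    and "avg_op Fi {1..n} xs = 0"
    and "\<And>i. i \<in> {1..n} \<Longrightarrow> (Li i)-lipschitz_on UNIV (Fi i)"
    and "\<And>i y. i \<in> {1..n} \<Longrightarrow>
           (Fi i y - Fi i xs) \<bullet> (y - xs) \<ge> \<mu>i i * (norm (y - xs))\<^sup>2"
    and "\<And>S. S \<in> batches n b \<Longrightarrow> L S > 0"
    and "\<And>S. S \<in> batches n b \<Longrightarrow> (L S)-lipschitz_on UNIV (avg_op Fi S)"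
    and "\<And>S. S \<in> batches n b \<Longrightarrow> \<mu> S \<ge> 1 / real b * (\<Sum>i\<in>S. \<mu>i i)"
    and "\<And>S. S \<in> batches n b \<Longrightarrow> \<bar>\<mu> S\<bar> \<le> L S"
    and "\<And>S y. S \<in> batches n b \<Longrightarrow>
           (avg_op Fi S y - avg_op Fi S xs) \<bullet> (y - xs) \<ge> \<mu> S * (norm (y - xs))\<^sup>2"
    and "mubar \<ge> 0"
    and "nice_sampling M n b \<xi>"
    and "0 < \<alpha>" and "\<alpha> < 1"
    and "0 < \<gamma>" and "\<gamma> \<le> 1 / (6 * L_nice n b L)"
    and "\<And>S. S \<in> batches n b \<Longrightarrow> \<gamma>1 S = \<gamma>"
    and "\<And>S. S \<in> batches n b \<Longrightarrow> \<gamma>2 S = \<alpha> * \<gamma>1 S"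
  shows "unified_assumption M x (\<lambda>k \<omega>. \<gamma>2 (\<xi> k \<omega>)) g xs
           (2 * \<alpha>)
           (1 / 2)
           0
           (6 * \<alpha>\<^sup>2 * \<gamma>\<^sup>2 * sigma2)
           (3 * \<alpha> * \<gamma>\<^sup>2 / 2 * sigma2)
           (\<alpha> * \<gamma> * mubar / 2)
           (\<lambda>k \<omega>. \<alpha> * \<gamma>\<^sup>2 * w (x k \<omega>)) \<and>
         (\<alpha> \<le> 1 / 4 \<longrightarrow> (\<forall>K.
            (mubar > 0 \<longrightarrow>
               (\<integral>\<omega>. (norm (x (K + 1) \<omega> - xs))\<^sup>2 \<partial>M)
                 \<le> (1 - \<alpha> * \<gamma> * mubar / 2) * (\<integral>\<omega>. (norm (x K \<omega> - xs))\<^sup>2 \<partial>M)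
                    + 3 * \<alpha> / 2 * (4 * \<alpha> + 1) * \<gamma>\<^sup>2 * sigma2 \<and>
               (\<integral>\<omega>. (norm (x K \<omega> - xs))\<^sup>2 \<partial>M)
                 \<le> (1 - \<alpha> * \<gamma> * mubar / 2) ^ K * (norm (x0 - xs))\<^sup>2
                    + 3 * (4 * \<alpha> + 1) * \<gamma> * sigma2 / mubar) \<and>
            (mubar = 0 \<longrightarrow>
               1 / (real K + 1) * (\<Sum>k = 0..K. \<integral>\<omega>. w (x k \<omega>) \<partial>M)
                 \<le> 2 * (norm (x0 - xs))\<^sup>2 / (\<alpha> * \<gamma>\<^sup>2 * (real K + 1))
                    + 3 * (4 * \<alpha> + 1) * sigma2)))"
proof -
  have b: "1 \<le> b" "b \<le> n" using \<open>b \<in> {1..n}\<close> by auto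
  have nonempty: "batches n b \<noteq> {}"
    using b(2) card_batches[of n b] by (metis card.empty zero_less_binomial less_irrefl)
  have step_le: "\<gamma> * L S \<le> 1 / 6" if S: "S \<in> batches n b" for S
  proof -
    have le: "L S \<le> L_nice n b L"
      unfolding L_nice_def using S finite_batches by (intro Max_ge) auto
    moreover have "0 < L S" using S by fact
    ultimately have "\<gamma> * L_nice n b L \<le> 1 / 6"
      using \<open>\<gamma> \<le> 1 / (6 * L_nice n b L)\<close> by (simp add: field_simps)
    moreover have "\<gamma> * L S \<le> \<gamma> * L_nice n b L"
      using le \<open>0 < \<gamma>\<close> by (intro mult_left_mono) auto
    ultimately show ?thesis by simp
  qed
  interpret nice_extragradient "avg_op Fi" xs n b L \<mu> \<gamma>
  proof unfold_locales
    show "(\<Sum>S\<in>batches n b. avg_op Fi S xs) = 0"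
      by (rule sum_batches_avg_op_eq_0) fact+
    show "0 \<le> mu_nice n b \<mu>" using \<open>mubar \<ge> 0\<close> by (simp add: mubar_def)
  qed (fact b step_le | fact)+
  interpret prob_space M
    using \<open>nice_sampling M n b \<xi>\<close> by (simp add: nice_sampling_def)
  interpret uniform_sampling M "batches n b" \<xi>
    using \<open>nice_sampling M n b \<xi>\<close> finite_batches
    by unfold_locales (auto simp: nice_sampling_def)
  have w: "w = gap" by (simp add: w_def gap_def coeff_def fun_eq_iff)
  have sigma2: "sigma2 = noise" by (simp add: sigma2_def sigma2_nice_def noise_def)
  have \<gamma>1: "\<gamma>1 S = \<gamma>" and \<gamma>2: "\<gamma>2 S = \<alpha> * \<gamma>" if "S \<in> batches n b" for S
    using that assms by simp_all
  have sseg_dir: "sseg_dir (avg_op Fi) \<gamma>1 S y = dir S y" if "S \<in> batches n b" for S y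
    using that by (simp add: sseg_dir_def dir_def \<gamma>1)
  have x_Suc: "x (Suc k) \<omega> = x k \<omega> - \<gamma>2 (\<xi> k \<omega>) *\<^sub>R g k \<omega>" for k \<omega>
    by (simp add: x_def g_def)
  have simple_x: "simple_function M (x k)" for k
    unfolding x_def by (rule simple_iterate)
  have int_x: "integrable M (\<lambda>\<omega>. f (x k \<omega>))" for f :: "real ^ 'd \<Rightarrow> real" and k
    by (rule integrable_simple[OF simple_function_compose1[OF simple_x]])
  have int_\<xi>x: "integrable M (\<lambda>\<omega>. f (\<xi> k \<omega>) (x k \<omega>))" for f :: "nat set \<Rightarrow> real ^ 'd \<Rightarrow> real" and k
    by (rule integrable_simple[OF simple_function_compose2[OF simple_\<xi> simple_x]])
  have mubar_step: "0 \<le> \<alpha> * \<gamma> * mubar / 2" "\<alpha> * \<gamma> * mubar / 2 \<le> 1"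
  proof -
    show "0 \<le> \<alpha> * \<gamma> * mubar / 2" using \<open>0 < \<alpha>\<close> \<open>0 < \<gamma>\<close> \<open>mubar \<ge> 0\<close> by simp
    have "\<alpha> * (\<gamma> * mubar) \<le> 1 * (1 / 6)"
      using step_mu_nice_le \<open>0 < \<alpha>\<close> \<open>\<alpha> < 1\<close> \<open>0 < \<gamma>\<close> \<open>mubar \<ge> 0\<close>
      unfolding mubar_def by (intro mult_mono) auto
    thus "\<alpha> * \<gamma> * mubar / 2 \<le> 1" by (simp add: mult.assoc)
  qed

  \<comment> \<open>The inner product and the second moment of the unified assumption, with sample and iterate
    separated as in \<open>cond_exp_given_fresh_sample\<close>.\<close>
  define hP where "hP S y = \<gamma>2 S * (sseg_dir (avg_op Fi) \<gamma>1 S y \<bullet> (y - xs))" for S y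
  define hQ where "hQ S y = (\<gamma>2 S)\<^sup>2 * (norm (sseg_dir (avg_op Fi) \<gamma>1 S y))\<^sup>2" for S y
  have cont: "continuous_on UNIV (sseg_dir (avg_op Fi) \<gamma>1 S)" if S: "S \<in> batches n b" for S
  proof -
    have F: "continuous_on UNIV (avg_op Fi S)"
      using lipschitz[OF S] by (rule lipschitz_on_continuous_on)
    have "continuous_on UNIV (\<lambda>y. y - \<gamma>1 S *\<^sub>R avg_op Fi S y)"
      by (rule continuous_on_diff[OF continuous_on_id continuous_on_scaleR[OF continuous_on_const F]])
    from continuous_on_compose2[OF F this subset_UNIV] show ?thesis
      by (simp add: sseg_dir_def[abs_def])
  qed
  have hP_meas: "hP S \<in> borel_measurable borel" and hQ_meas: "hQ S \<in> borel_measurable borel"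
    if "S \<in> batches n b" for S
    unfolding hP_def[abs_def] hQ_def[abs_def]
    by (intro borel_measurable_continuous_onI continuous_intros cont that)+
  have hP_mean: "1 / real (card (batches n b)) * (\<Sum>S\<in>batches n b. hP S y) = \<alpha> * progress y" for y
  proof -
    have "(\<Sum>S\<in>batches n b. hP S y) = (\<Sum>S\<in>batches n b. \<alpha> * (\<gamma> * (dir S y \<bullet> (y - xs))))"
      by (intro sum.cong refl) (simp add: hP_def sseg_dir \<gamma>2)
    thus ?thesis
      by (simp add: progress_def batch_mean_def card_batches sum_distrib_left[symmetric])
  qed
  have hQ_mean: "1 / real (card (batches n b)) * (\<Sum>S\<in>batches n b. hQ S y) = \<alpha>\<^sup>2 * energy y" for y
  proof -
    have "(\<Sum>S\<in>batches n b. hQ S y) = (\<Sum>S\<in>batches n b. \<alpha>\<^sup>2 * (\<gamma>\<^sup>2 * (norm (dir S y))\<^sup>2))"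
      by (intro sum.cong refl) (simp add: hQ_def sseg_dir \<gamma>2 power_mult_distrib)
    thus ?thesis
      by (simp add: energy_def batch_mean_def card_batches sum_distrib_left[symmetric])
  qed
  have cond_P: "AE \<omega> in M. cond_exp_given M (x k) (\<lambda>\<omega>. hP (\<xi> k \<omega>) (x k \<omega>)) \<omega> = \<alpha> * progress (x k \<omega>)"
    and cond_Q: "AE \<omega> in M. cond_exp_given M (x k) (\<lambda>\<omega>. hQ (\<xi> k \<omega>) (x k \<omega>)) \<omega> = \<alpha>\<^sup>2 * energy (x k \<omega>)"
    for k
    using cond_exp_given_fresh_sample[where h = hP, OF hP_meas]
      cond_exp_given_fresh_sample[where h = hQ, OF hQ_meas]
    unfolding hP_mean hQ_mean x_def by blast+
  have bounds: "\<alpha>\<^sup>2 * energy y \<le> 2 * (2 * \<alpha>) * (\<alpha> * progress y) + 0 * (norm (y - xs))\<^sup>2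
        + 6 * \<alpha>\<^sup>2 * \<gamma>\<^sup>2 * sigma2"
      "\<alpha> * progress y \<ge> \<alpha> * \<gamma> * mubar / 2 * (norm (y - xs))\<^sup>2 + 1 / 2 * (\<alpha> * \<gamma>\<^sup>2 * w y)
        - 3 * \<alpha> * \<gamma>\<^sup>2 / 2 * sigma2" for y
  proof -
    have "\<alpha>\<^sup>2 * energy y \<le> \<alpha>\<^sup>2 * (4 * progress y + 6 * \<gamma>\<^sup>2 * noise)"
      by (rule mult_left_mono[OF energy_le_progress]) simp
    thus "\<alpha>\<^sup>2 * energy y \<le> 2 * (2 * \<alpha>) * (\<alpha> * progress y) + 0 * (norm (y - xs))\<^sup>2
        + 6 * \<alpha>\<^sup>2 * \<gamma>\<^sup>2 * sigma2"
      by (simp add: sigma2 distrib_left power2_eq_square mult.assoc mult.left_commute)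
    have "\<alpha> * progress y \<ge> \<alpha> * (\<gamma> * mu_nice n b \<mu> / 2 * (norm (y - xs))\<^sup>2 + \<gamma>\<^sup>2 / 2 * gap y
        - 3 / 2 * \<gamma>\<^sup>2 * noise)"
      using \<open>0 < \<alpha>\<close> by (intro mult_left_mono progress_lower) auto
    thus "\<alpha> * progress y \<ge> \<alpha> * \<gamma> * mubar / 2 * (norm (y - xs))\<^sup>2 + 1 / 2 * (\<alpha> * \<gamma>\<^sup>2 * w y)
        - 3 * \<alpha> * \<gamma>\<^sup>2 / 2 * sigma2"
      by (simp add: sigma2 w mubar_def algebra_simps)
  qed
  have unified: "unified_assumption M x (\<lambda>k \<omega>. \<gamma>2 (\<xi> k \<omega>)) g xs (2 * \<alpha>) (1 / 2) 0
      (6 * \<alpha>\<^sup>2 * \<gamma>\<^sup>2 * sigma2) (3 * \<alpha> * \<gamma>\<^sup>2 / 2 * sigma2) (\<alpha> * \<gamma> * mubar / 2)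
      (\<lambda>k \<omega>. \<alpha> * \<gamma>\<^sup>2 * w (x k \<omega>))"
    unfolding unified_assumption_def Let_def
  proof (intro conjI allI ballI)
    fix k
    have P: "(\<lambda>\<omega>. \<gamma>2 (\<xi> k \<omega>) * (g k \<omega> \<bullet> (x k \<omega> - xs))) = (\<lambda>\<omega>. hP (\<xi> k \<omega>) (x k \<omega>))"
      and Q: "(\<lambda>\<omega>. (\<gamma>2 (\<xi> k \<omega>))\<^sup>2 * (norm (g k \<omega>))\<^sup>2) = (\<lambda>\<omega>. hQ (\<xi> k \<omega>) (x k \<omega>))"
      by (simp_all add: hP_def hQ_def g_def)
    show "x k \<in> borel_measurable M"
      by (rule borel_measurable_simple_function[OF simple_x])
    show "integrable M (\<lambda>\<omega>. \<gamma>2 (\<xi> k \<omega>) * (g k \<omega> \<bullet> (x k \<omega> - xs)))"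
      and "integrable M (\<lambda>\<omega>. (\<gamma>2 (\<xi> k \<omega>))\<^sup>2 * (norm (g k \<omega>))\<^sup>2)"
      unfolding P Q by (rule int_\<xi>x)+
    show "AE \<omega> in M.
        cond_exp_given M (x k) (\<lambda>\<omega>. (\<gamma>2 (\<xi> k \<omega>))\<^sup>2 * (norm (g k \<omega>))\<^sup>2) \<omega>
          \<le> 2 * (2 * \<alpha>) * cond_exp_given M (x k) (\<lambda>\<omega>. \<gamma>2 (\<xi> k \<omega>) * (g k \<omega> \<bullet> (x k \<omega> - xs))) \<omega>
            + 0 * (norm (x k \<omega> - xs))\<^sup>2 + 6 * \<alpha>\<^sup>2 * \<gamma>\<^sup>2 * sigma2 \<and>
        \<alpha> * \<gamma> * mubar / 2 * (norm (x k \<omega> - xs))\<^sup>2 + 1 / 2 * (\<alpha> * \<gamma>\<^sup>2 * w (x k \<omega>))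
            - 3 * \<alpha> * \<gamma>\<^sup>2 / 2 * sigma2
          \<le> cond_exp_given M (x k) (\<lambda>\<omega>. \<gamma>2 (\<xi> k \<omega>) * (g k \<omega> \<bullet> (x k \<omega> - xs))) \<omega>"
      unfolding P Q using cond_P[of k] cond_Q[of k]
    proof eventually_elim
      case (elim \<omega>)
      show ?case unfolding elim using bounds[of "x k \<omega>"] by (rule conjI)
    qed
  qed (use \<open>0 < \<alpha>\<close> \<open>0 < \<gamma>\<close> mubar_step x_Suc in \<open>simp_all add: w sigma2 gap_nonneg noise_nonneg\<close>)

  define E where "E k = (\<integral>\<omega>. (norm (x k \<omega> - xs))\<^sup>2 \<partial>M)" for k
  define W where "W k = (\<integral>\<omega>. w (x k \<omega>) \<partial>M)" for k
  define D where "D = 3 * \<alpha> / 2 * (4 * \<alpha> + 1) * \<gamma>\<^sup>2 * sigma2"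
  have E0: "E 0 = (norm (x0 - xs))\<^sup>2"
    by (simp add: E_def x_def prob_space)
  have E_nonneg: "0 \<le> E k" for k by (simp add: E_def)
  have W_nonneg: "0 \<le> W k" for k by (simp add: W_def w gap_nonneg)
  have D_nonneg: "0 \<le> D" using \<open>0 < \<alpha>\<close> by (simp add: D_def sigma2 noise_nonneg)
  have descent: "E (Suc k) \<le> (1 - \<alpha> * \<gamma> * mubar / 2) * E k - \<alpha> * \<gamma>\<^sup>2 / 2 * W k + D"
    if "\<alpha> \<le> 1 / 4" for k
  proof -
    let ?h = "\<lambda>S y. (norm (y - (\<alpha> * \<gamma>) *\<^sub>R dir S y - xs))\<^sup>2"
    have "E (Suc k) = (\<integral>\<omega>. ?h (\<xi> k \<omega>) (x k \<omega>) \<partial>M)"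
      unfolding E_def
      by (rule Bochner_Integration.integral_cong) (simp_all add: x_Suc g_def \<xi>_in sseg_dir \<gamma>2)
    also have "\<dots> = (\<integral>\<omega>. batch_mean n b (\<lambda>S. ?h S (x k \<omega>)) \<partial>M)"
      using fresh_sample_expectation[where h = ?h] by (simp add: x_def batch_mean_def card_batches)
    also have "\<dots> \<le> (\<integral>\<omega>. (1 - \<alpha> * \<gamma> * mubar / 2) * (norm (x k \<omega> - xs))\<^sup>2
        - \<alpha> * \<gamma>\<^sup>2 / 2 * w (x k \<omega>) + D \<partial>M)"
      unfolding mubar_def w D_def sigma2
      by (rule integral_mono[OF int_x int_x]) (rule mean_step_le[OF \<open>0 < \<alpha>\<close> that])
    also have "\<dots> = (1 - \<alpha> * \<gamma> * mubar / 2) * E k - \<alpha> * \<gamma>\<^sup>2 / 2 * W k + D"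
      using int_x[of "\<lambda>y. (norm (y - xs))\<^sup>2" k] int_x[of w k] by (simp add: E_def W_def prob_space)
    finally show ?thesis .
  qed
  have rates: "(mubar > 0 \<longrightarrow>
          E (K + 1) \<le> (1 - \<alpha> * \<gamma> * mubar / 2) * E K + 3 * \<alpha> / 2 * (4 * \<alpha> + 1) * \<gamma>\<^sup>2 * sigma2 \<and>
          E K \<le> (1 - \<alpha> * \<gamma> * mubar / 2) ^ K * (norm (x0 - xs))\<^sup>2
             + 3 * (4 * \<alpha> + 1) * \<gamma> * sigma2 / mubar) \<and>
        (mubar = 0 \<longrightarrow>
          1 / (real K + 1) * (\<Sum>k = 0..K. W k)
            \<le> 2 * (norm (x0 - xs))\<^sup>2 / (\<alpha> * \<gamma>\<^sup>2 * (real K + 1)) + 3 * (4 * \<alpha> + 1) * sigma2)"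
    if \<alpha>: "\<alpha> \<le> 1 / 4" for K
  proof (intro conjI impI)
    have contraction: "E (Suc k) \<le> (1 - \<alpha> * \<gamma> * mubar / 2) * E k + D" for k
    proof -
      have "0 \<le> \<alpha> * \<gamma>\<^sup>2 / 2 * W k" using \<open>0 < \<alpha>\<close> W_nonneg[of k] by simp
      thus ?thesis using descent[OF \<alpha>, of k] by linarith
    qed
    show "E (K + 1) \<le> (1 - \<alpha> * \<gamma> * mubar / 2) * E K + 3 * \<alpha> / 2 * (4 * \<alpha> + 1) * \<gamma>\<^sup>2 * sigma2"
      using contraction[of K] by (simp add: D_def)
    assume "mubar > 0"
    hence pos: "0 < \<alpha> * \<gamma> * mubar / 2" using \<open>0 < \<alpha>\<close> \<open>0 < \<gamma>\<close> by simp
    have "D / (\<alpha> * \<gamma> * mubar / 2) = 3 * (4 * \<alpha> + 1) * \<gamma> * sigma2 / mubar"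
      using \<open>0 < \<alpha>\<close> \<open>0 < \<gamma>\<close> \<open>mubar > 0\<close> by (simp add: D_def field_simps power2_eq_square)
    thus "E K \<le> (1 - \<alpha> * \<gamma> * mubar / 2) ^ K * (norm (x0 - xs))\<^sup>2
        + 3 * (4 * \<alpha> + 1) * \<gamma> * sigma2 / mubar"
      using contraction_with_noise[of E, OF contraction pos mubar_step(2) D_nonneg, of K]
      by (simp add: E0)
  next
    assume "mubar = 0"
    hence step: "E (Suc k) \<le> E k - \<alpha> * \<gamma>\<^sup>2 / 2 * W k + D" for k
      using descent[OF \<alpha>, of k] by simp
    \<comment> \<open>The factor that turns the telescoped weights \<open>\<alpha>\<gamma>\<^sup>2/2\<close> into a plain average.\<close>
    define c where "c = 2 / (\<alpha> * \<gamma>\<^sup>2 * (real K + 1))"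
    have c: "0 \<le> c" using \<open>0 < \<alpha>\<close> by (simp add: c_def)
    have "(\<Sum>k = 0..K. \<alpha> * \<gamma>\<^sup>2 / 2 * W k) \<le> (norm (x0 - xs))\<^sup>2 + (real K + 1) * D"
      using telescoped_descent[of E, OF step E_nonneg] by (simp add: E0)
    hence "c * (\<alpha> * \<gamma>\<^sup>2 / 2 * (\<Sum>k = 0..K. W k)) \<le> c * ((norm (x0 - xs))\<^sup>2 + (real K + 1) * D)"
      using c unfolding sum_distrib_left[symmetric] by (rule mult_left_mono)
    moreover have "c * (\<alpha> * \<gamma>\<^sup>2 / 2 * s) = 1 / (real K + 1) * s" for s
      using \<open>0 < \<alpha>\<close> \<open>0 < \<gamma>\<close> by (simp add: c_def divide_simps)
    moreover have "c * ((real K + 1) * D) = 3 * (4 * \<alpha> + 1) * sigma2"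
    proof -
      have "c * (real K + 1) = 2 / (\<alpha> * \<gamma>\<^sup>2)"
        by (simp add: c_def divide_simps)
      moreover have "2 / (\<alpha> * \<gamma>\<^sup>2) * D = 3 * (4 * \<alpha> + 1) * sigma2"
        using \<open>0 < \<alpha>\<close> \<open>0 < \<gamma>\<close> by (simp add: D_def field_simps)
      ultimately show ?thesis by (metis mult.assoc)
    qed
    ultimately show "1 / (real K + 1) * (\<Sum>k = 0..K. W k)
        \<le> 2 * (norm (x0 - xs))\<^sup>2 / (\<alpha> * \<gamma>\<^sup>2 * (real K + 1)) + 3 * (4 * \<alpha> + 1) * sigma2"
      by (simp add: distrib_left c_def)
  qed
  show ?thesis
    using unified rates unfolding E_def W_def by blast
qed

end
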